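(* Let $\Sigma$ be a finite alphabet, let $w,v\in\Sigma^+$ and let $n\ge2$. Then $$w\sim_n v \iff [g_u^w]=[g_u^v]\ \text{ for all } u\in\Sigma^d,\ 1\le d\le n-1,$$ or equivalently, $w\sim_n v$ if and only if the signatures of $w$ and $v$ in $\mathcal{UT}_n(\mathbb{T})$ are equal.
   Context: Let $\mathbb{T}=(\mathbb{R}\cup\{-\infty\},\oplus,\odot)$ be the tropical semifield, $x\oplus y=\max(x,y)$, $x\odot y=x+y$. $\mathcal{UT}_n(\mathbb{T})$ is the semigroup, under tropical matrix multiplication, of all $n\times n$ matrices $M$ over $\mathbb{T}$ with $M_{ij}=-\infty$ whenever $i>j$. $\Sigma^+$ is the free semigroup on $\Sigma$, and $\Sigma^d$ the set of words of length $d$. $w\sim_n v$ means that $\varphi(w)=\varphi(v)$ for every semigroup morphism $\varphi:\Sigma^+\to\mathcal{UT}_n(\mathbb{T})$. For $w\in\Sigma^+$ and $u=u_1\cdots u_d\in\Sigma^d$, $d\ge1$, define the formal tropical polynomial, in variables $x(s,k)$ with $s\in\Sigma$, $1\le k\le d$, $$g_u^w:=\bigoplus_{\pi\in I}\ \bigodot_{s\in\Sigma}\ \bigodot_{k=1}^{d} x(s,k)^{N_s^w(\pi_{k-1},\pi_k)},$$ where $I$ is the set of all integer sequences $(\pi_0,\dots,\pi_{d+1})$ with $0=\pi_0<\pi_1<\cdots<\pi_{d+1}=|w|+1$ and $w_{\pi_k}=u_k$ for $1\le k\le d$, and $N_s^w(\pi_{k-1},\pi_k)$ is the number of occurrences of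 the letter $s$ in $w$ at positions strictly between $\pi_{k-1}$ and $\pi_k$. Powers are tropical, so that as a function $g_u^w(x)=\max_{\pi\in I}\sum_{s,k}N_s^w(\pi_{k-1},\pi_k)\,x(s,k)$ for real values of the variables, and $g_u^w\equiv-\infty$ if $I=\emptyset$. $[f]=[g]$ means that the tropical polynomials $f,g$ define the same function on real inputs. The Newton polytope of a tropical polynomial is the convex hull of its set of exponent vectors (empty if there are no monomials). The $d$-signature of $w$ is the lexicographically ordered sequence $(\mathsf{Newt}(g_u^w):u\in\Sigma^d)$, and the signature of $w$ in $\mathcal{UT}_n(\mathbb{T})$ is the sequence of its $d$-signatures for $1\le d\le n-1$. *)

theory Defs
  imports
    "HOL-Analysis.Convex"
    "HOL-Analysis.Finite_Function_Topology"
    "HOL-Library.List_Lexorder"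
    "Jordan_Normal_Form.Matrix"
begin

datatype trop = NegInf | Fin real

text \<open>The overloaded semiring symbols denote the tropical operations: on this type \<open>+\<close> is
  the maximum, \<open>*\<close> is real addition, \<open>0\<close> is minus infinity and \<open>1\<close> is the real number zero.
  Hence \<open>*\<close> on \<open>trop mat\<close> is tropical matrix multiplication, and \<open>upper_triangular\<close>
  says that the entries below the diagonal are minus infinity.\<close>

instantiation trop :: comm_semiring_1
begin

definition zero_trop :: trop where "0 = NegInf"

definition one_trop :: trop where "1 = Fin 0"

fun plus_trop :: "trop \<Rightarrow> trop \<Rightarrow> trop" where
  "NegInf + y = y"
| "Fin a + NegInf = Fin a"
| "Fin a + Fin b = Fin (max a b)"

fun times_trop :: "trop \<Rightarrow> trop \<Rightarrow> trop" where
  "NegInf * y = NegInf"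
| "Fin a * NegInf = NegInf"
| "Fin a * Fin b = Fin (a + b)"

instance
proof
  fix a b c :: trop
  show "a + b + c = a + (b + c)" by (cases a; cases b; cases c) auto
  show "a + b = b + a" by (cases a; cases b) auto
  show "0 + a = a" by (simp add: zero_trop_def)
  show "a * b * c = a * (b * c)" by (cases a; cases b; cases c) auto
  show "a * b = b * a" by (cases a; cases b) auto
  show "1 * a = a" by (cases a) (auto simp: one_trop_def)
  show "(a + b) * c = a * c + b * c" by (cases a; cases b; cases c) auto
  show "0 * a = 0" by (simp add: zero_trop_def)
  show "a * 0 = 0" by (cases a) (auto simp: zero_trop_def)
  show "(0::trop) \<noteq> 1" by (simp add: zero_trop_def one_trop_def)
qed

end

definition UT :: "nat \<Rightarrow> trop mat set" where
  "UT n = {M \<in> carrier_mat n n. upper_triangular M}"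

lemma UT_times_closed:
  assumes "A \<in> UT n" "B \<in> UT n"
  shows "A * B \<in> UT n"
proof -
  have "(\<Sum>k = 0..<n. A $$ (i, k) * B $$ (k, j)) = 0" if "i < n" "j < i" for i j
  proof (rule sum.neutral, rule ballI)
    fix k assume k: "k \<in> {0..<n}"
    show "A $$ (i, k) * B $$ (k, j) = 0"
    proof (cases "k < i")
      case True
      then have "A $$ (i, k) = 0" using assms that by (auto simp: UT_def)
      then show ?thesis by simp
    next
      case False
      then have "B $$ (k, j) = 0" using assms that k by (auto simp: UT_def)
      then show ?thesis by simp
    qed
  qed
  then show ?thesis
    using assms by (auto simp: UT_def scalar_prod_def)
qed

text \<open>The free semigroup on \<open>'a\<close> consists of the nonempty lists under concatenation; the value of
  a morphism at the empty list is irrelevant.\<close>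

definition free_semigroup_hom :: "('a list \<Rightarrow> 'b::times) \<Rightarrow> 'b set \<Rightarrow> bool" where
  "free_semigroup_hom \<phi> S \<longleftrightarrow>
     (\<forall>x. x \<noteq> [] \<longrightarrow> \<phi> x \<in> S) \<and>
     (\<forall>x y. x \<noteq> [] \<longrightarrow> y \<noteq> [] \<longrightarrow> \<phi> (x @ y) = \<phi> x * \<phi> y)"

definition UT_equiv :: "nat \<Rightarrow> 'a list \<Rightarrow> 'a list \<Rightarrow> bool" where
  "UT_equiv n w v \<longleftrightarrow> (\<forall>\<phi>. free_semigroup_hom \<phi> (UT n) \<longrightarrow> \<phi> w = \<phi> v)"

text \<open>Formal tropical polynomials: finitely supported maps from exponent vectors to coefficients,
  so that \<open>+\<close>, \<open>*\<close> and \<open>^\<close> are the tropical operations on polynomials.\<close>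

type_synonym 'v trop_poly = "('v \<Rightarrow>\<^sub>0 nat) \<Rightarrow>\<^sub>0 trop"

definition trop_var :: "'v \<Rightarrow> 'v trop_poly" where
  "trop_var v = Poly_Mapping.single (Poly_Mapping.single v 1) 1"

definition trop_eval :: "'v trop_poly \<Rightarrow> ('v \<Rightarrow> trop) \<Rightarrow> trop" where
  "trop_eval f x =
     (\<Sum>m \<in> Poly_Mapping.keys f. Poly_Mapping.lookup f m *
        (\<Prod>v \<in> Poly_Mapping.keys m. x v ^ Poly_Mapping.lookup m v))"

definition same_function :: "'v trop_poly \<Rightarrow> 'v trop_poly \<Rightarrow> bool" where
  "same_function f g \<longleftrightarrow>
     (\<forall>x :: 'v \<Rightarrow> real. trop_eval f (\<lambda>v. Fin (x v)) = trop_eval g (\<lambda>v. Fin (x v)))"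

text \<open>The polytope lives in the space of finitely supported real vectors indexed by all variables;
  coordinates of variables that do not occur in the polynomial are zero.\<close>

definition Newt :: "'v trop_poly \<Rightarrow> ('v \<Rightarrow>\<^sub>0 real) set" where
  "Newt f = convex hull (Poly_Mapping.map real ` Poly_Mapping.keys f)"

text \<open>Positions in words are counted from 1, so the \<open>i\<close>-th letter of \<open>w\<close> is \<open>w ! (i - 1)\<close>.\<close>

definition position_seqs :: "'a list \<Rightarrow> 'a list \<Rightarrow> nat list set" where
  "position_seqs u w = {\<pi>. length \<pi> = length u + 2 \<and> \<pi> ! 0 = 0 \<and>
     \<pi> ! (length u + 1) = length w + 1 \<and> sorted_wrt (<) \<pi> \<and>
     (\<forall>k \<in> {1..length u}. w ! (\<pi> ! k - 1) = u ! (k - 1))}"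

lemma finite_position_seqs: "finite (position_seqs u w)"
proof (rule finite_subset)
  let ?B = "{\<pi>. set \<pi> \<subseteq> {..length w + 1} \<and> length \<pi> = length u + 2}"
  show "finite ?B" by (rule finite_lists_length_eq) simp
  show "position_seqs u w \<subseteq> ?B"
  proof
    fix \<pi> assume p: "\<pi> \<in> position_seqs u w"
    have "\<pi> ! i \<le> length w + 1" if "i < length u + 2" for i
    proof (cases "i = length u + 1")
      case True
      then show ?thesis using p by (simp add: position_seqs_def)
    next
      case False
      then have "\<pi> ! i < \<pi> ! (length u + 1)"
        using p that by (intro sorted_wrt_nth_less[of "(<)"]) (auto simp: position_seqs_def)
      then show ?thesis using p by (simp add: position_seqs_def)
    qed
    then show "\<pi> \<in> ?B" using p by (auto simp: position_seqs_def in_set_conv_nth)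
  qed
qed

definition occurrences :: "'a list \<Rightarrow> 'a \<Rightarrow> nat \<Rightarrow> nat \<Rightarrow> nat" where
  "occurrences w s a b = card {i \<in> {1..length w}. a < i \<and> i < b \<and> w ! (i - 1) = s}"

text \<open>The variable \<open>x(s, k)\<close> is represented by the pair \<open>(s, k)\<close>; only \<open>1 \<le> k \<le> length u\<close> occurs.\<close>

definition g_poly :: "'a::finite list \<Rightarrow> 'a list \<Rightarrow> ('a \<times> nat) trop_poly" where
  "g_poly u w =
     (\<Sum>\<pi> \<in> position_seqs u w. \<Prod>s \<in> UNIV. \<Prod>k \<in> {1..length u}.
        trop_var (s, k) ^ occurrences w s (\<pi> ! (k - 1)) (\<pi> ! k))"

text \<open>Words are compared by the lexicographic order on lists, so \<open>sorted_list_of_set\<close> enumerates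
  the words of length \<open>d\<close> lexicographically.\<close>

definition d_signature ::
    "nat \<Rightarrow> 'a::{finite,linorder} list \<Rightarrow> ('a \<times> nat \<Rightarrow>\<^sub>0 real) set list" where
  "d_signature d w = map (\<lambda>u. Newt (g_poly u w)) (sorted_list_of_set {u. length u = d})"

definition signature ::
    "nat \<Rightarrow> 'a::{finite,linorder} list \<Rightarrow> ('a \<times> nat \<Rightarrow>\<^sub>0 real) set list list" where
  "signature n w = map (\<lambda>d. d_signature d w) [1..<n]"

end

theory Submission
  imports Defs "HOL-Analysis.Convex_Euclidean_Space"
begin

text \<open>The theorem follows from a cycle of implications: equality in \<open>UT n\<close> forces the
  functions of the \<open>g_poly u\<close> to agree, equal functions have equal Newton polytopes, and equal
  polytopes force equality in \<open>UT n\<close>.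

  The two steps that involve matrices rest on one description of their products. An entry \<open>(i, j)\<close>
  of the product of upper triangular matrices along a word \<open>w\<close> is the maximal weight of a walk from
  \<open>i\<close> to \<open>j\<close> labelled by \<open>w\<close>. Such a walk moves through a strictly increasing chain of at most \<open>n\<close> states; the letters
  at which it moves form a word \<open>u\<close> of length at most \<open>n - 1\<close>, and the letters between two moves
  are spent in loops. So a walk is a factorization \<open>w = b\<^sub>0 u\<^sub>1 b\<^sub>1 \<dots> u\<^sub>d b\<^sub>d\<close>, and its weight is a
  factor that depends on \<open>u\<close> and the chain only, times a tropical monomial whose exponents are the
  letter counts of the blocks (\<open>path_weight_le_word_mat\<close>, \<open>word_mat_attained_by_path\<close>). These
  counts, without those of the last block, are exactly the exponents of \<open>g_poly u w\<close>
  (\<open>keys_g_poly\<close>).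

  From matrices to functions: for given real \<open>x\<close>, matrices that carry the values \<open>x (s, k)\<close> on the
  diagonal and allow only the moves spelled by \<open>u\<close> have the value of \<open>g_poly u w\<close> at \<open>x\<close> as the
  entry \<open>(0, d)\<close> of their product (\<open>staircase_mat_entry\<close>).

  From functions to polytopes: all coefficients are tropical ones, so the function is the support
  function of the finite set of exponents. A point outside the hull of the other set would be
  separated from it by a linear functional, at which the two functions differ
  (\<open>Newt_mono_of_function_le\<close>).

  From polytopes to matrices: the polytopes of the one-letter words, which are at hand because
  \<open>n \<ge> 2\<close>, determine how often each letter occurs. Hence the letter counts of the last block are the
  same affine function of those of the other blocks for \<open>w\<close> and for \<open>v\<close>, and the counts of a
  factorization of \<open>w\<close>, last block included, are a convex combination of those of factorizations of
  \<open>v\<close>.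
  A tropical monomial, even at arguments that may be minus infinity, is bounded at such a
  combination by its value at one of the combined points (\<open>tropical_monomial_convex\<close>). So every
  walk along \<open>w\<close> is matched by a walk along \<open>v\<close> that is at least as heavy, and vice versa.\<close>

section \<open>The order of the tropical semiring\<close>

text \<open>With the natural order the entry of a matrix product is the largest weight of a walk. Equations
  between tropical sums then split into two inequalities between single terms and sums.\<close>

instantiation trop :: linorder
begin

definition less_eq_trop :: "trop \<Rightarrow> trop \<Rightarrow> bool" where
  "x \<le> y \<longleftrightarrow> x + y = (y :: trop)"

definition less_trop :: "trop \<Rightarrow> trop \<Rightarrow> bool" where
  "x < y \<longleftrightarrow> x \<le> y \<and> \<not> y \<le> (x :: trop)"

instance
proof
  fix x y z :: trop
  show "x < y \<longleftrightarrow> x \<le> y \<and> \<not> y \<le> x" by (rule less_trop_def)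
  show "x \<le> x" by (cases x) (auto simp: less_eq_trop_def)
  show "x \<le> z" if "x \<le> y" "y \<le> z"
    using that unfolding less_eq_trop_def by (metis add.assoc)
  show "x = y" if "x \<le> y" "y \<le> x"
    using that unfolding less_eq_trop_def by (metis add.commute)
  show "x \<le> y \<or> y \<le> x"
    by (cases x; cases y) (auto simp: less_eq_trop_def max_def)
qed

end

instance trop :: dioid
proof
  fix x y :: trop
  show "x \<le> y \<longleftrightarrow> (\<exists>z. y = x + z)"
  proof
    assume "\<exists>z. y = x + z"
    then obtain z where "y = x + z" ..
    then show "x \<le> y" by (cases x; cases z) (auto simp: less_eq_trop_def)
  qed (metis less_eq_trop_def)
qed

instance trop :: semiring_1_no_zero_divisors
proof
  fix x y :: trop
  assume "x \<noteq> 0" "y \<noteq> 0"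
  then show "x * y \<noteq> 0" by (cases x; cases y) (auto simp: zero_trop_def)
qed

lemma Fin_nonzero [simp]: "Fin a \<noteq> 0"
  by (simp add: zero_trop_def)

lemma Fin_le_iff [simp]: "Fin a \<le> Fin b \<longleftrightarrow> a \<le> b"
  by (auto simp: less_eq_trop_def)

lemma Fin_power: "Fin a ^ m = Fin (real m * a)"
  by (induction m) (auto simp: one_trop_def algebra_simps)

lemma Fin_prod: "(\<Prod>i\<in>A. Fin (f i)) = Fin (\<Sum>i\<in>A. f i)"
  by (induction A rule: infinite_finite_induct) (auto simp: one_trop_def)

lemma trop_sum_attained:
  fixes f :: "'i \<Rightarrow> trop"
  assumes "(\<Sum>i\<in>A. f i) \<noteq> 0"
  obtains i where "i \<in> A" "(\<Sum>i\<in>A. f i) = f i"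
  using assms
proof (induction A arbitrary: thesis rule: infinite_finite_induct)
  case (insert a A)
  show ?case
  proof (cases "(\<Sum>i\<in>A. f i) \<le> f a")
    case True
    then have "(\<Sum>i\<in>insert a A. f i) = f a"
      using insert.hyps by (simp add: less_eq_trop_def add.commute)
    then show thesis using insert.prems by blast
  next
    case False
    then have "f a \<le> (\<Sum>i\<in>A. f i)" by simp
    then have eq: "(\<Sum>i\<in>insert a A. f i) = (\<Sum>i\<in>A. f i)"
      using insert.hyps by (simp add: less_eq_trop_def)
    then have "(\<Sum>i\<in>A. f i) \<noteq> 0" using insert.prems by simp
    then obtain i where "i \<in> A" "(\<Sum>i\<in>A. f i) = f i" using insert.IH by blast
    then show thesis using insert.prems(1) eq by auto
  qed
qed auto

lemma trop_member_le_sum: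
  fixes f :: "'i \<Rightarrow> trop"
  assumes "finite A" "i \<in> A"
  shows "f i \<le> (\<Sum>i\<in>A. f i)"
  using assms by (intro member_le_sum) auto

section \<open>Convex combinations of exponent vectors\<close>

text \<open>At finite arguments a tropical monomial is linear in its exponents, so its value at a convex
  combination cannot exceed all the values that are averaged. Arguments equal to minus infinity do no harm: if the
  left-hand monomial is not minus infinity, then its exponents vanish at these arguments, hence so
  do those of every point with positive weight, because exponents are nonnegative.\<close>

lemma tropical_monomial_convex:
  fixes y :: "'v \<Rightarrow> trop" and e :: "'v \<Rightarrow> nat" and f :: "'i \<Rightarrow> 'v \<Rightarrow> nat" and c :: "'i \<Rightarrow> real"
  assumes V: "finite V" and I: "finite I"
    and c: "\<And>i. i \<in> I \<Longrightarrow> 0 \<le> c i" "sum c I = 1"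
    and e: "\<And>v. v \<in> V \<Longrightarrow> real (e v) = (\<Sum>i\<in>I. c i * real (f i v))"
  shows "\<exists>i\<in>I. (\<Prod>v\<in>V. y v ^ e v) \<le> (\<Prod>v\<in>V. y v ^ f i v)"
proof (cases "(\<Prod>v\<in>V. y v ^ e v) = 0")
  case True
  moreover have "I \<noteq> {}" using c(2) by auto
  ultimately show ?thesis by auto
next
  case False
  define z where "z v = (case y v of Fin a \<Rightarrow> a | NegInf \<Rightarrow> 0)" for v
  have pow: "y v ^ m = Fin (real m * z v)" if "y v = NegInf \<longrightarrow> m = 0" for v m
  proof (cases "y v")
    case NegInf
    then show ?thesis using that by (simp add: one_trop_def)
  qed (simp add: z_def Fin_power)
  have val: "(\<Prod>v\<in>V. y v ^ g v) = Fin (\<Sum>v\<in>V. real (g v) * z v)"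
    if "\<And>v. v \<in> V \<Longrightarrow> y v = NegInf \<Longrightarrow> g v = 0" for g :: "'v \<Rightarrow> nat"
    using that by (simp add: pow flip: Fin_prod)
  have e0: "e v = 0" if "v \<in> V" "y v = NegInf" for v
  proof (rule ccontr)
    assume "e v \<noteq> 0"
    then have "y v ^ e v = 0" using that(2) by (simp add: zero_trop_def [symmetric])
    then have "(\<Prod>v\<in>V. y v ^ e v) = 0" using that(1) V by (intro prod_zero) auto
    then show False using False by simp
  qed
  define E where "E = (\<Sum>v\<in>V. real (e v) * z v)"
  define S where "S i = (\<Sum>v\<in>V. real (f i v) * z v)" for i
  have ES: "E = (\<Sum>i\<in>I. c i * S i)"
  proof -
    have "E = (\<Sum>v\<in>V. \<Sum>i\<in>I. c i * (real (f i v) * z v))"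
      unfolding E_def by (intro sum.cong refl) (simp add: e sum_distrib_right mult.assoc)
    also have "\<dots> = (\<Sum>i\<in>I. c i * S i)"
      unfolding S_def sum_distrib_left by (rule sum.swap)
    finally show ?thesis .
  qed
  \<comment> \<open>The positive weight is what forces the exponents of this point to vanish where those of \<open>e\<close> do.\<close>
  obtain i where i: "i \<in> I" "0 < c i" "E \<le> S i"
  proof (rule ccontr)
    assume "\<not> thesis"
    then have less: "S i < E" if "i \<in> I" "0 < c i" for i
      using that \<open>\<And>i. _ \<Longrightarrow> _ \<Longrightarrow> _ \<Longrightarrow> thesis\<close> by force
    have "\<exists>j\<in>I. 0 < c j"
    proof (rule ccontr)
      assume "\<not> (\<exists>j\<in>I. 0 < c j)"
      then have "sum c I \<le> 0" by (intro sum_nonpos) (auto simp: not_less)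
      then show False using c(2) by simp
    qed
    then obtain j where j: "j \<in> I" "0 < c j" by blast
    have "(\<Sum>i\<in>I. c i * S i) < (\<Sum>i\<in>I. c i * E)"
    proof (rule sum_strict_mono_ex1)
      show "\<forall>i\<in>I. c i * S i \<le> c i * E"
        using less c(1) by (metis le_less mult_left_mono mult_zero_left)
      show "\<exists>i\<in>I. c i * S i < c i * E" using less j by (auto intro!: bexI[of _ j])
    qed (rule I)
    then show False using ES c(2) by (simp flip: sum_distrib_right)
  qed
  have f0: "f i v = 0" if "v \<in> V" "y v = NegInf" for v
  proof -
    have "(\<Sum>j\<in>I. c j * real (f j v)) = 0" using e e0 that by force
    then have "c i * real (f i v) = 0"
      using i(1) I c(1) by (subst (asm) sum_nonneg_eq_0_iff) auto
    then show ?thesis using i(2) by simp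
  qed
  have "(\<Prod>v\<in>V. y v ^ e v) \<le> (\<Prod>v\<in>V. y v ^ f i v)"
    using val[of e] val[of "f i"] e0 f0 i(3) by (simp add: E_def S_def)
  then show ?thesis using i(1) by blast
qed

section \<open>Separating a point from a finitely generated polytope\<close>

lemma lookup_scaleR [simp]:
  fixes p :: "'v \<Rightarrow>\<^sub>0 'b::real_vector"
  shows "Poly_Mapping.lookup (r *\<^sub>R p) v = r *\<^sub>R Poly_Mapping.lookup p v"
proof -
  have "finite {v. r *\<^sub>R Poly_Mapping.lookup p v \<noteq> 0}"
    by (rule finite_subset[OF _ finite_lookup[of p]]) auto
  then show ?thesis by (simp add: scaleR_poly_mapping_def)
qed

lemma continuous_on_lookup:
  fixes S :: "('v \<Rightarrow>\<^sub>0 real) set"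
  shows "continuous_on S (\<lambda>p. Poly_Mapping.lookup p v)"
proof -
  have "bounded_linear (\<lambda>p :: 'v \<Rightarrow>\<^sub>0 real. Poly_Mapping.lookup p v)"
  proof (rule bounded_linear_intro[where K = 1])
    fix p :: "'v \<Rightarrow>\<^sub>0 real"
    show "norm (Poly_Mapping.lookup p v) \<le> norm p * 1"
    proof (cases "v \<in> Poly_Mapping.keys p")
      case True
      then show ?thesis
        by (simp add: norm_poly_mapping_def dist_poly_mapping_def)
          (rule member_le_sum[where f = "\<lambda>n. \<bar>Poly_Mapping.lookup p n\<bar>"], auto)
    qed (simp add: in_keys_iff)
  qed (simp_all add: lookup_add)
  then show ?thesis by (rule linear_continuous_on)
qed

text \<open>The normal vector is the difference of \<open>p\<close> and the nearest point \<open>m\<close> of the hull, which exists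
  because the hull of a nonempty finite set is compact. Nearest is meant in the Euclidean distance on the
  finitely many coordinates in \<open>K\<close>; the norm of the space of finitely supported functions is the
  sum norm, which serves only for compactness.\<close>

lemma convex_hull_finite_separation:
  fixes p :: "'v \<Rightarrow>\<^sub>0 real" and S :: "('v \<Rightarrow>\<^sub>0 real) set"
  assumes S: "finite S" and p: "p \<notin> convex hull S"
    and K: "finite K" "\<And>q. q \<in> insert p S \<Longrightarrow> Poly_Mapping.keys q \<subseteq> K"
  obtains a :: "'v \<Rightarrow> real" where
    "\<And>q. q \<in> S \<Longrightarrow> (\<Sum>v\<in>K. a v * Poly_Mapping.lookup q v) < (\<Sum>v\<in>K. a v * Poly_Mapping.lookup p v)"
proof (cases "S = {}")
  case True
  then show ?thesis using that by auto
next
  case False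
  let ?l = "Poly_Mapping.lookup"
  define D where "D q = (\<Sum>v\<in>K. (?l p v - ?l q v)\<^sup>2)" for q
  have "compact (convex hull S)" using S by (rule finite_imp_compact_convex_hull)
  moreover have "continuous_on (convex hull S) D"
    unfolding D_def by (intro continuous_intros continuous_on_lookup)
  ultimately obtain m where m: "m \<in> convex hull S" "\<And>q. q \<in> convex hull S \<Longrightarrow> D m \<le> D q"
    using continuous_attains_inf[of "convex hull S" D] False by auto
  define a where "a v = ?l p v - ?l m v" for v
  have mK: "Poly_Mapping.keys m \<subseteq> K"
  proof -
    have "convex {q :: 'v \<Rightarrow>\<^sub>0 real. Poly_Mapping.keys q \<subseteq> K}"
      by (auto simp: convex_def subset_iff in_keys_iff lookup_add) (metis add_0 mult_zero_right)
    then have "convex hull S \<subseteq> {q. Poly_Mapping.keys q \<subseteq> K}"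
      using K by (intro hull_minimal) auto
    then show ?thesis using m(1) by auto
  qed
  have "D m > 0"
  proof (rule ccontr)
    assume "\<not> D m > 0"
    moreover have "D m \<ge> 0" unfolding D_def by (intro sum_nonneg) simp
    ultimately have "D m = 0" by simp
    then have "\<forall>v\<in>K. ?l p v = ?l m v"
      unfolding D_def using K(1) by (subst (asm) sum_nonneg_eq_0_iff) auto
    then have "?l p v = ?l m v" for v
      using mK K(2)[of p] by (metis in_keys_iff insertI1 subsetD)
    then have "p = m" by (rule poly_mapping_eqI)
    then show False using p m(1) by simp
  qed
  \<comment> \<open>Otherwise moving \<open>m\<close> by a small fraction \<open>t\<close> of the way to \<open>q\<close> would bring it nearer to \<open>p\<close>.\<close>
  have obtuse: "(\<Sum>v\<in>K. a v * (?l q v - ?l m v)) \<le> 0" if "q \<in> S" for q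
  proof (rule ccontr)
    define b where "b = (\<Sum>v\<in>K. a v * (?l q v - ?l m v))"
    define d where "d = (\<Sum>v\<in>K. (?l q v - ?l m v)\<^sup>2)"
    assume "\<not> (\<Sum>v\<in>K. a v * (?l q v - ?l m v)) \<le> 0"
    then have b: "b > 0" by (simp add: b_def)
    have d: "d \<ge> 0" by (simp add: d_def sum_nonneg)
    define t where "t = min 1 (b / (d + 1))"
    have t: "0 < t" "t \<le> 1" "t * d < 2 * b"
    proof -
      show "0 < t" "t \<le> 1" using b d by (auto simp: t_def)
      have "t * d \<le> b / (d + 1) * d" unfolding t_def using d by (intro mult_right_mono) auto
      also have "\<dots> \<le> b" using b d by (simp add: field_simps)
      finally show "t * d < 2 * b" using b by simp
    qed
    have lk: "?l ((1 - t) *\<^sub>R m + t *\<^sub>R q) v = (1 - t) * ?l m v + t * ?l q v" for v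
      by (simp add: lookup_add)
    have "(1 - t) *\<^sub>R m + t *\<^sub>R q \<in> convex hull S"
      using m(1) hull_inc[OF that] t by (intro convexD[OF convex_convex_hull]) auto
    then have "D m \<le> D ((1 - t) *\<^sub>R m + t *\<^sub>R q)" by (rule m(2))
    also have "\<dots> = (\<Sum>v\<in>K. (a v)\<^sup>2 + t * t * (?l q v - ?l m v)\<^sup>2 - 2 * t * (a v * (?l q v - ?l m v)))"
      unfolding D_def a_def
      by (intro sum.cong refl) (simp only: lk power2_eq_square, simp add: algebra_simps)
    also have "\<dots> = D m + t * (t * d - 2 * b)"
      unfolding D_def a_def b_def d_def
      by (simp add: sum.distrib sum_subtractf sum_distrib_left algebra_simps)
    finally have "0 \<le> t * (t * d - 2 * b)" by simp
    then show False using t by (simp add: zero_le_mult_iff)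
  qed
  show ?thesis
  proof (rule that[of a])
    fix q assume "q \<in> S"
    have "(\<Sum>v\<in>K. a v * ?l p v) - (\<Sum>v\<in>K. a v * ?l q v)
        = D m - (\<Sum>v\<in>K. a v * (?l q v - ?l m v))"
      unfolding D_def a_def
      by (simp add: sum_subtractf[symmetric] power2_eq_square algebra_simps)
    then show "(\<Sum>v\<in>K. a v * ?l q v) < (\<Sum>v\<in>K. a v * ?l p v)"
      using obtuse[OF \<open>q \<in> S\<close>] \<open>D m > 0\<close> by linarith
  qed
qed

section \<open>Position sequences and factorizations of a word\<close>

text \<open>If \<open>bs\<close> has one entry more than \<open>u\<close>, this is the word \<open>b\<^sub>0 u\<^sub>1 b\<^sub>1 \<dots> u\<^sub>d b\<^sub>d\<close>; other lengths do not
  occur below.\<close>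

fun weave :: "'a list list \<Rightarrow> 'a list \<Rightarrow> 'a list" where
  "weave bs [] = concat bs"
| "weave [] (a # u) = []"
| "weave (b # bs) (a # u) = b @ a # weave bs u"

text \<open>The occurrences of \<open>u\<close> as a scattered subword of \<open>w\<close>, given by the blocks that surround its
  letters. They carry the same information as position sequences but follow the recursion of
  lists.\<close>

definition factorizations :: "'a list \<Rightarrow> 'a list \<Rightarrow> 'a list list set" where
  "factorizations u w = {bs. length bs = Suc (length u) \<and> weave bs u = w}"

lemma occurrences_conv_count:
  assumes "\<And>i. i < length b \<Longrightarrow> w ! (x + i) = b ! i" and "x + length b \<le> length w"
    and "y = Suc (x + length b)"
  shows "occurrences w s x y = count_list b s"
proof -
  have "count_list b s = card {i. i < length b \<and> b ! i = s}"
    by (simp add: count_list_eq_length_filter length_filter_conv_card eq_commute)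
  also have "\<dots> = card ((\<lambda>i. Suc (x + i)) ` {i. i < length b \<and> b ! i = s})"
    by (rule card_image [symmetric]) (auto simp: inj_on_def)
  also have "(\<lambda>i. Suc (x + i)) ` {i. i < length b \<and> b ! i = s}
      = {i \<in> {1..length w}. x < i \<and> i < y \<and> w ! (i - 1) = s}"
  proof (intro equalityI subsetI)
    fix j assume j: "j \<in> {i \<in> {1..length w}. x < i \<and> i < y \<and> w ! (i - 1) = s}"
    then have "j = Suc (x + (j - Suc x))" "j - Suc x < length b" using assms(3) by auto
    moreover have "b ! (j - Suc x) = s"
      using j assms(1)[of "j - Suc x"] \<open>j - Suc x < length b\<close> by auto
    ultimately show "j \<in> (\<lambda>i. Suc (x + i)) ` {i. i < length b \<and> b ! i = s}" by blast
  qed (use assms in auto)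
  finally show ?thesis by (simp add: occurrences_def)
qed

lemma occurrences_shift:
  "occurrences (b @ a # w) s (Suc (length b) + x) (Suc (length b) + y) = occurrences w s x y"
proof -
  let ?m = "Suc (length b)"
  have "{i \<in> {1..length (b @ a # w)}. ?m + x < i \<and> i < ?m + y \<and> (b @ a # w) ! (i - 1) = s}
      = (\<lambda>i. ?m + i) ` {i \<in> {1..length w}. x < i \<and> i < y \<and> w ! (i - 1) = s}"
  proof (intro equalityI subsetI)
    fix j assume j: "j \<in> {i \<in> {1..length (b @ a # w)}. ?m + x < i \<and> i < ?m + y \<and> (b @ a # w) ! (i - 1) = s}"
    then have "j = ?m + (j - ?m)" "j - ?m \<in> {i \<in> {1..length w}. x < i \<and> i < y \<and> w ! (i - 1) = s}"
      by (auto simp: nth_append nth_Cons' split: if_splits)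
    then show "j \<in> (\<lambda>i. ?m + i) ` {i \<in> {1..length w}. x < i \<and> i < y \<and> w ! (i - 1) = s}" by blast
  qed (auto simp: nth_append nth_Cons')
  then show ?thesis unfolding occurrences_def by (simp only:) (intro card_image inj_onI, simp)
qed

lemma position_seqs_Nil: "position_seqs [] w = {[0, Suc (length w)]}"
proof -
  have "\<pi> = [0, Suc (length w)]" if "length \<pi> = 2" "\<pi> ! 0 = 0" "\<pi> ! 1 = Suc (length w)" for \<pi> :: "nat list"
    using that by (auto simp: length_Suc_conv numeral_2_eq_2)
  then show ?thesis by (auto simp: position_seqs_def numeral_2_eq_2)
qed

text \<open>The first selected position splits \<open>w\<close> into the block before it and a rest; the later positions,
  counted from the first one, form a position sequence for the rest.\<close>

lemma position_seqs_Cons: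
  "position_seqs (a # u) w =
     {0 # map ((+) (Suc (length b))) \<pi> | b w' \<pi>. w = b @ a # w' \<and> \<pi> \<in> position_seqs u w'}"
proof (intro equalityI subsetI)
  fix \<rho> assume \<rho>: "\<rho> \<in> position_seqs (a # u) w"
  then obtain \<sigma> where \<sigma>: "\<rho> = 0 # \<sigma>"
    by (cases \<rho>) (auto simp: position_seqs_def)
  then obtain p \<tau> where p: "\<sigma> = p # \<tau>" using \<rho> by (cases \<sigma>) (auto simp: position_seqs_def)
  have len: "length \<sigma> = length u + 2" and last: "\<sigma> ! (length u + 1) = length w + 1"
    and sorted: "sorted_wrt (<) \<sigma>" and "0 < p"
    and letters: "\<And>k. k \<le> length u \<Longrightarrow> w ! (\<sigma> ! k - 1) = (a # u) ! k"
  proof -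
    show "w ! (\<sigma> ! k - 1) = (a # u) ! k" if "k \<le> length u" for k
    proof -
      have "\<forall>k\<in>{1..length (a # u)}. w ! (\<rho> ! k - 1) = (a # u) ! (k - 1)"
        using \<rho> unfolding position_seqs_def by blast
      from bspec[OF this, of "Suc k"] show ?thesis using that by (simp add: \<sigma>)
    qed
  qed (use \<rho> in \<open>simp_all add: position_seqs_def \<sigma> p\<close>)
  have "p < length w + 1"
    using sorted_wrt_nth_less[OF sorted, of 0 "length u + 1"] len last p by simp
  have "\<sigma> ! k \<ge> p" if "k < length \<sigma>" for k
    using sorted that by (cases k) (auto simp: p less_imp_le)
  define \<pi> where "\<pi> = map (\<lambda>x. x - p) \<sigma>"
  have \<pi>nth: "\<pi> ! k = \<sigma> ! k - p" if "k < length u + 2" for k using that len by (simp add: \<pi>_def)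
  have "\<pi> \<in> position_seqs u (drop p w)"
    unfolding position_seqs_def
  proof (intro CollectI conjI ballI)
    show "length \<pi> = length u + 2" using len by (simp add: \<pi>_def)
    show "\<pi> ! 0 = 0" by (simp add: \<pi>_def p)
    show "\<pi> ! (length u + 1) = length (drop p w) + 1"
      using last \<open>p < length w + 1\<close> by (simp add: \<pi>nth)
    show "sorted_wrt (<) \<pi>"
      unfolding \<pi>_def sorted_wrt_map
      by (rule sorted_wrt_mono_rel[OF _ sorted])
         (metis \<open>\<And>k. k < length \<sigma> \<Longrightarrow> p \<le> \<sigma> ! k\<close> diff_less_mono in_set_conv_nth)
    fix k assume k: "k \<in> {1..length u}"
    have "p < \<sigma> ! k" using sorted_wrt_nth_less[OF sorted, of 0 k] k len p by simp
    then have "p + (\<sigma> ! k - p - 1) = \<sigma> ! k - 1" by simp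
    then show "drop p w ! (\<pi> ! k - 1) = u ! (k - 1)"
      using letters[of k] k \<open>p < length w + 1\<close> by (simp add: \<pi>nth nth_Cons')
  qed
  moreover have "w = take (p - 1) w @ a # drop p w"
    using letters[of 0] p \<open>0 < p\<close> \<open>p < length w + 1\<close> id_take_nth_drop[of "p - 1" w] by simp
  moreover have "\<rho> = 0 # map ((+) (Suc (length (take (p - 1) w)))) \<pi>"
    unfolding \<sigma> \<pi>_def using \<open>0 < p\<close> \<open>p < length w + 1\<close> \<open>\<And>k. k < length \<sigma> \<Longrightarrow> p \<le> \<sigma> ! k\<close>
    by (auto intro!: nth_equalityI)
  ultimately show "\<rho> \<in> {0 # map ((+) (Suc (length b))) \<pi> | b w' \<pi>. w = b @ a # w' \<and> \<pi> \<in> position_seqs u w'}"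
    by blast
next
  fix \<rho> assume "\<rho> \<in> {0 # map ((+) (Suc (length b))) \<pi> | b w' \<pi>. w = b @ a # w' \<and> \<pi> \<in> position_seqs u w'}"
  then obtain b w' \<pi> where \<rho>: "\<rho> = 0 # map ((+) (Suc (length b))) \<pi>"
    and w: "w = b @ a # w'" and \<pi>: "\<pi> \<in> position_seqs u w'" by blast
  have "\<rho> ! Suc k = Suc (length b) + \<pi> ! k" if "k < length u + 2" for k
    using that \<pi> by (simp add: \<rho> position_seqs_def)
  moreover have "w ! (\<rho> ! k - 1) = (a # u) ! (k - 1)" if k: "k \<in> {1..length (a # u)}" for k
  proof (cases "k = 1")
    case True
    then show ?thesis using \<pi> by (simp add: \<rho> w position_seqs_def)
  next
    case False
    then obtain j where j: "k = Suc (Suc j)" "j < length u" using k by (cases k; cases "k - 1") auto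
    have "\<pi> ! 0 < \<pi> ! Suc j"
      using \<pi> j by (intro sorted_wrt_nth_less[of "(<)"]) (auto simp: position_seqs_def)
    moreover have "w' ! (\<pi> ! Suc j - 1) = u ! j" using \<pi> j by (auto simp: position_seqs_def)
    moreover have "\<rho> ! k = Suc (length b) + \<pi> ! Suc j" using \<pi> j by (simp add: \<rho> position_seqs_def)
    ultimately show ?thesis using j by (simp add: w nth_append nth_Cons')
  qed
  ultimately show "\<rho> \<in> position_seqs (a # u) w"
    using \<pi> by (auto simp: position_seqs_def \<rho> w sorted_wrt_map)
qed

lemma factorizations_Nil: "factorizations [] w = {[w]}"
  by (auto simp: factorizations_def length_Suc_conv)

lemma factorizations_Cons:
  "factorizations (a # u) w = {b # bs | b bs w'. w = b @ a # w' \<and> bs \<in> factorizations u w'}"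
  by (auto simp: factorizations_def length_Suc_conv)

lemma position_seqs_nth_0: "\<pi> \<in> position_seqs u w \<Longrightarrow> \<pi> ! 0 = 0"
  by (simp add: position_seqs_def)

lemma length_position_seqs: "\<pi> \<in> position_seqs u w \<Longrightarrow> length \<pi> = length u + 2"
  by (simp add: position_seqs_def)

definition gap_counts :: "'a list \<Rightarrow> nat \<Rightarrow> nat list \<Rightarrow> ('a \<Rightarrow> nat) list" where
  "gap_counts w d \<pi> = map (\<lambda>k. \<lambda>s. occurrences w s (\<pi> ! k) (\<pi> ! Suc k)) [0..<Suc d]"

text \<open>The gaps of a position sequence are the blocks of a factorization, so both describe the same
  collection of letter counts. This is all that is needed, since adding tropical monomials
  depends only on the set of their exponents.\<close>

lemma gap_counts_image:
  "gap_counts w (length u) ` position_seqs u w = map count_list ` factorizations u w"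
proof (induction u arbitrary: w)
  case Nil
  have "occurrences w s 0 (Suc (length w)) = count_list w s" for s
    by (rule occurrences_conv_count) auto
  then show ?case by (simp add: position_seqs_Nil factorizations_Nil gap_counts_def fun_eq_iff)
next
  case (Cons a u)
  have step: "gap_counts (b @ a # w') (length (a # u)) (0 # map ((+) (Suc (length b))) \<pi>)
      = count_list b # gap_counts w' (length u) \<pi>" if \<pi>: "\<pi> \<in> position_seqs u w'" for b w' \<pi>
  proof (rule nth_equalityI)
    fix k assume k: "k < length (gap_counts (b @ a # w') (length (a # u)) (0 # map ((+) (Suc (length b))) \<pi>))"
    show "gap_counts (b @ a # w') (length (a # u)) (0 # map ((+) (Suc (length b))) \<pi>) ! k
      = (count_list b # gap_counts w' (length u) \<pi>) ! k"
    proof (cases k)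
      case 0
      have "occurrences (b @ a # w') s 0 (Suc (length b)) = count_list b s" for s
        by (rule occurrences_conv_count) (auto simp: nth_append)
      then show ?thesis using 0 \<pi> position_seqs_nth_0[OF \<pi>] length_position_seqs[OF \<pi>]
        by (auto simp: gap_counts_def nth_append simp del: upt_Suc)
    next
      case (Suc j)
      then have "j < Suc (length u)" using k by (simp add: gap_counts_def)
      moreover have "(0 # map ((+) (Suc (length b))) \<pi>) ! Suc i = Suc (length b) + \<pi> ! i"
        if "i \<le> Suc j" for i
        using that \<open>j < Suc (length u)\<close> length_position_seqs[OF \<pi>] by simp
      ultimately show ?thesis
        using Suc unfolding gap_counts_def by (simp only: occurrences_shift nth_map length_upt nth_upt
          list.size nth_Cons_Suc length_map) (simp add: occurrences_shift del: upt_Suc add_Suc)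
    qed
  qed (simp add: gap_counts_def)
  have "gap_counts w (length (a # u)) ` position_seqs (a # u) w
      = {count_list b # q | b w' q. w = b @ a # w' \<and> q \<in> gap_counts w' (length u) ` position_seqs u w'}"
    (is "?L = ?R")
  proof (intro equalityI subsetI)
    fix q assume "q \<in> ?L"
    then obtain b w' \<pi> where "w = b @ a # w'" "\<pi> \<in> position_seqs u w'"
      "q = gap_counts w (length (a # u)) (0 # map ((+) (Suc (length b))) \<pi>)"
      unfolding position_seqs_Cons by blast
    then show "q \<in> ?R" using step[of \<pi> w' b] by blast
  next
    fix q assume "q \<in> ?R"
    then obtain b w' \<pi> where "w = b @ a # w'" "\<pi> \<in> position_seqs u w'"
      "q = count_list b # gap_counts w' (length u) \<pi>" by blast
    moreover from this have "0 # map ((+) (Suc (length b))) \<pi> \<in> position_seqs (a # u) w"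
      unfolding position_seqs_Cons by blast
    ultimately show "q \<in> ?L" using step[of \<pi> w' b] by (metis image_eqI)
  qed
  also have "\<dots> = map count_list ` factorizations (a # u) w"
    unfolding Cons.IH factorizations_Cons
  proof (intro equalityI subsetI)
    fix q assume "q \<in> {count_list b # q | b w' q. w = b @ a # w' \<and> q \<in> map count_list ` factorizations u w'}"
    then obtain b w' bs where "w = b @ a # w'" "bs \<in> factorizations u w'" "q = map count_list (b # bs)"
      by auto
    then show "q \<in> map count_list ` {b # bs | b bs w'. w = b @ a # w' \<and> bs \<in> factorizations u w'}"
      by blast
  next
    fix q assume "q \<in> map count_list ` {b # bs | b bs w'. w = b @ a # w' \<and> bs \<in> factorizations u w'}"
    then obtain b w' bs where "w = b @ a # w'" "bs \<in> factorizations u w'" "q = map count_list (b # bs)"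
      by blast
    then show "q \<in> {count_list b # q | b w' q. w = b @ a # w' \<and> q \<in> map count_list ` factorizations u w'}"
      by auto
  qed
  finally show ?case .
qed

section \<open>The monomials of the polynomials and their Newton polytopes\<close>

lemma trop_var_power: "trop_var v ^ m = Poly_Mapping.single (Poly_Mapping.single v m) 1"
  by (induction m) (simp_all add: trop_var_def mult_single flip: single_add)

lemma prod_single_one:
  "(\<Prod>i\<in>A. Poly_Mapping.single (f i) (1 :: trop)) = Poly_Mapping.single (\<Sum>i\<in>A. f i) 1"
  by (induction A rule: infinite_finite_induct) (simp_all add: mult_single)

lemma lookup_sum_single_one:
  assumes "finite A"
  shows "Poly_Mapping.lookup (\<Sum>i\<in>A. Poly_Mapping.single (f i) (1 :: trop)) m = (1 when m \<in> f ` A)"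
  using assms
proof (induction A)
  case (insert a A)
  have "(1 :: trop) + 1 = 1" by (simp add: one_trop_def)
  then show ?case using insert by (auto simp: lookup_add lookup_single when_def)
qed simp

text \<open>The exponent vector of letter counts \<open>q\<close> given block by block. Blocks are numbered from 1 in the
  variables and from 0 in \<open>q\<close>, and blocks after the \<open>d\<close>-th are dropped.\<close>

definition exponent :: "nat \<Rightarrow> ('a::finite \<Rightarrow> nat) list \<Rightarrow> ('a \<times> nat \<Rightarrow>\<^sub>0 nat)" where
  "exponent d q = (\<Sum>s\<in>UNIV. \<Sum>k\<in>{1..d}. Poly_Mapping.single (s, k) ((q ! (k - 1)) s))"

lemma lookup_exponent:
  "Poly_Mapping.lookup (exponent d q) (s, k) = (if k \<in> {1..d} then (q ! (k - 1)) s else 0)"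
proof -
  have "Poly_Mapping.lookup (exponent d q) (s, k)
      = (\<Sum>t\<in>UNIV. \<Sum>l\<in>{1..d}. if t = s then if l = k then (q ! (k - 1)) s else 0 else 0)"
    unfolding exponent_def lookup_sum by (intro sum.cong refl) (auto simp: lookup_single when_def)
  also have "\<dots> = (\<Sum>t\<in>UNIV. if t = s then (if k \<in> {1..d} then (q ! (k - 1)) s else 0) else 0)"
    by (intro sum.cong refl) (simp add: sum.delta')
  finally show ?thesis by simp
qed

lemma g_poly_conv_sum_single:
  "g_poly u w = (\<Sum>\<pi>\<in>position_seqs u w.
     Poly_Mapping.single (exponent (length u) (gap_counts w (length u) \<pi>)) 1)"
proof -
  have "(gap_counts w (length u) \<pi> ! (k - 1)) s = occurrences w s (\<pi> ! (k - 1)) (\<pi> ! k)"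
    if "k \<in> {1..length u}" for \<pi> k s
    using that unfolding gap_counts_def by (subst nth_map) (auto simp del: upt_Suc)
  then show ?thesis
    unfolding g_poly_def exponent_def by (simp add: trop_var_power prod_single_one)
qed

text \<open>Equal monomials merge without changing the coefficient, because tropical addition is idempotent.\<close>

lemma lookup_g_poly:
  "Poly_Mapping.lookup (g_poly u w) m
     = (1 when m \<in> exponent (length u) ` map count_list ` factorizations u w)"
  unfolding g_poly_conv_sum_single
  by (simp add: lookup_sum_single_one finite_position_seqs image_image flip: gap_counts_image)

lemma keys_g_poly:
  "Poly_Mapping.keys (g_poly u w) = exponent (length u) ` map count_list ` factorizations u w"
  by (auto simp: in_keys_iff lookup_g_poly)

lemma lookup_g_poly_keys:
  "m \<in> Poly_Mapping.keys (g_poly u w) \<Longrightarrow> Poly_Mapping.lookup (g_poly u w) m = 1"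
  by (simp add: lookup_g_poly keys_g_poly)

lemma trop_eval_unit_coefficients:
  assumes "\<And>m. m \<in> Poly_Mapping.keys f \<Longrightarrow> Poly_Mapping.lookup f m = 1"
    and "finite K" "\<And>m. m \<in> Poly_Mapping.keys f \<Longrightarrow> Poly_Mapping.keys m \<subseteq> K"
  shows "trop_eval f y = (\<Sum>m\<in>Poly_Mapping.keys f. \<Prod>v\<in>K. y v ^ Poly_Mapping.lookup m v)"
  unfolding trop_eval_def
proof (rule sum.cong)
  fix m assume m: "m \<in> Poly_Mapping.keys f"
  have "(\<Prod>v\<in>Poly_Mapping.keys m. y v ^ Poly_Mapping.lookup m v) = (\<Prod>v\<in>K. y v ^ Poly_Mapping.lookup m v)"
    using assms m by (intro prod.mono_neutral_left) (auto simp: in_keys_iff)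
  then show "Poly_Mapping.lookup f m * (\<Prod>v\<in>Poly_Mapping.keys m. y v ^ Poly_Mapping.lookup m v)
      = (\<Prod>v\<in>K. y v ^ Poly_Mapping.lookup m v)"
    using assms(1) m by simp
qed simp

lemma lookup_map_real [simp]: "Poly_Mapping.lookup (Poly_Mapping.map real m) v = real (Poly_Mapping.lookup m v)"
  by (simp add: Poly_Mapping.map.rep_eq when_def)

text \<open>Suppose that a functional \<open>a\<close> separates an exponent vector of \<open>f\<close> from the polytope of \<open>g\<close>. Evaluated
  at \<open>a\<close>, each monomial becomes the value of the functional at its exponent vector, so \<open>f\<close> would
  exceed \<open>g\<close> there.\<close>

lemma Newt_mono_of_function_le:
  fixes f g :: "'v trop_poly"
  assumes f: "\<And>m. m \<in> Poly_Mapping.keys f \<Longrightarrow> Poly_Mapping.lookup f m = 1"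
    and g: "\<And>m. m \<in> Poly_Mapping.keys g \<Longrightarrow> Poly_Mapping.lookup g m = 1"
    and le: "\<And>x :: 'v \<Rightarrow> real. trop_eval f (\<lambda>v. Fin (x v)) \<le> trop_eval g (\<lambda>v. Fin (x v))"
  shows "Newt f \<subseteq> Newt g"
  unfolding Newt_def
proof (rule hull_minimal, rule image_subsetI, rule ccontr)
  let ?l = "Poly_Mapping.lookup" and ?N = "Poly_Mapping.map real ` Poly_Mapping.keys g"
  fix m assume m: "m \<in> Poly_Mapping.keys f" and out: "Poly_Mapping.map real m \<notin> convex hull ?N"
  define K where "K = (\<Union>m\<in>Poly_Mapping.keys f \<union> Poly_Mapping.keys g. Poly_Mapping.keys m)"
  have K: "finite K" by (simp add: K_def)
  have sub: "Poly_Mapping.keys m \<subseteq> K" if "m \<in> Poly_Mapping.keys f \<union> Poly_Mapping.keys g" for m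
    using that by (auto simp: K_def)
  have keys_map: "Poly_Mapping.keys (Poly_Mapping.map real m) = Poly_Mapping.keys m" for m :: "'v \<Rightarrow>\<^sub>0 nat"
    by (auto simp: in_keys_iff)
  obtain a where a: "\<And>q. q \<in> ?N \<Longrightarrow>
      (\<Sum>v\<in>K. a v * ?l q v) < (\<Sum>v\<in>K. a v * ?l (Poly_Mapping.map real m) v)"
  proof (rule convex_hull_finite_separation[OF _ out K])
    show "Poly_Mapping.keys q \<subseteq> K" if "q \<in> insert (Poly_Mapping.map real m) ?N" for q
      using that m by (auto simp: K_def keys_map)
  qed (blast | simp)+
  define L where "L m = (\<Sum>v\<in>K. a v * real (?l m v))" for m
  have mono: "(\<Prod>v\<in>K. Fin (a v) ^ ?l m v) = Fin (L m)" for m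
    by (simp add: Fin_power Fin_prod L_def mult.commute)
  have evf: "trop_eval f (\<lambda>v. Fin (a v)) = (\<Sum>m\<in>Poly_Mapping.keys f. Fin (L m))"
    using sub by (subst trop_eval_unit_coefficients[OF f K]) (auto simp: mono)
  have evg: "trop_eval g (\<lambda>v. Fin (a v)) = (\<Sum>m\<in>Poly_Mapping.keys g. Fin (L m))"
    using sub by (subst trop_eval_unit_coefficients[OF g K]) (auto simp: mono)
  have "Fin (L m) \<le> trop_eval f (\<lambda>v. Fin (a v))"
    unfolding evf using m by (intro trop_member_le_sum) auto
  also have "\<dots> \<le> trop_eval g (\<lambda>v. Fin (a v))" by (rule le)
  finally have ge: "Fin (L m) \<le> (\<Sum>m\<in>Poly_Mapping.keys g. Fin (L m))" by (simp add: evg)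
  then have "(\<Sum>m\<in>Poly_Mapping.keys g. Fin (L m)) \<noteq> 0" by auto
  then obtain m' where m': "m' \<in> Poly_Mapping.keys g" "(\<Sum>m\<in>Poly_Mapping.keys g. Fin (L m)) = Fin (L m')"
    by (rule trop_sum_attained)
  have "L m' < L m" using a[of "Poly_Mapping.map real m'"] m'(1) by (simp add: L_def)
  then show False using ge m'(2) by simp
qed (rule convex_convex_hull)

lemma prod_exponent:
  fixes y :: "'a::finite \<times> nat \<Rightarrow> trop"
  shows "(\<Prod>v\<in>UNIV \<times> {1..d}. y v ^ Poly_Mapping.lookup (exponent d q) v)
    = (\<Prod>k<d. \<Prod>s\<in>UNIV. y (s, Suc k) ^ (q ! k) s)"
proof -
  have "(\<Prod>v\<in>UNIV \<times> {1..d}. y v ^ Poly_Mapping.lookup (exponent d q) v)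
      = (\<Prod>s\<in>UNIV. \<Prod>k\<in>{1..d}. y (s, k) ^ (q ! (k - 1)) s)"
    unfolding prod.cartesian_product by (intro prod.cong) (auto simp: lookup_exponent)
  also have "\<dots> = (\<Prod>k\<in>{1..d}. \<Prod>s\<in>UNIV. y (s, k) ^ (q ! (k - 1)) s)"
    by (rule prod.swap)
  also have "\<dots> = (\<Prod>k<d. \<Prod>s\<in>UNIV. y (s, Suc k) ^ (q ! k) s)"
    by (rule prod.reindex_bij_witness[of _ Suc "\<lambda>k. k - 1"]) auto
  finally show ?thesis .
qed

lemma trop_eval_g_poly:
  "trop_eval (g_poly u w) y = (\<Sum>m\<in>Poly_Mapping.keys (g_poly u w).
     \<Prod>v\<in>UNIV \<times> {1..length u}. y v ^ Poly_Mapping.lookup m v)"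
proof (rule trop_eval_unit_coefficients[OF lookup_g_poly_keys])
  fix m assume "m \<in> Poly_Mapping.keys (g_poly u w)"
  then show "Poly_Mapping.keys m \<subseteq> UNIV \<times> {1..length u}"
    by (auto simp: keys_g_poly in_keys_iff lookup_exponent split: if_splits)
qed simp_all

text \<open>The inclusion of polytopes, spelled out in terms of blocks; the points of \<open>I\<close> merely serve as
  indices. Nothing is said about the last block, which the exponents do not record.\<close>

lemma Newt_subset_convex_combination:
  fixes u w v :: "'a::finite list"
  assumes sub: "Newt (g_poly u w) \<subseteq> Newt (g_poly u v)" and bs: "bs \<in> factorizations u w"
  obtains I :: "('a \<times> nat \<Rightarrow>\<^sub>0 real) set" and c h where
    "finite I" "\<And>i. i \<in> I \<Longrightarrow> 0 \<le> c i" "sum c I = 1"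
    "\<And>i. i \<in> I \<Longrightarrow> h i \<in> factorizations u v"
    "\<And>k s. k < length u \<Longrightarrow> real (count_list (bs ! k) s) = (\<Sum>i\<in>I. c i * real (count_list (h i ! k) s))"
proof -
  let ?E = "\<lambda>bs. Poly_Mapping.map real (exponent (length u) (map count_list bs))"
  define I where "I = Poly_Mapping.map real ` Poly_Mapping.keys (g_poly u v)"
  have I: "finite I" by (simp add: I_def)
  have "?E bs \<in> Newt (g_poly u w)"
    unfolding Newt_def using bs by (intro hull_inc) (auto simp: keys_g_poly)
  then have "?E bs \<in> convex hull I" using sub by (auto simp: Newt_def I_def)
  then obtain c where c: "\<And>i. i \<in> I \<Longrightarrow> 0 \<le> c i" "sum c I = 1" "(\<Sum>i\<in>I. c i *\<^sub>R i) = ?E bs"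
    unfolding convex_hull_finite[OF I] by blast
  have "\<forall>i\<in>I. \<exists>bs'\<in>factorizations u v. i = ?E bs'" by (auto simp: I_def keys_g_poly)
  then obtain h where h: "\<And>i. i \<in> I \<Longrightarrow> h i \<in> factorizations u v" "\<And>i. i \<in> I \<Longrightarrow> i = ?E (h i)"
    by metis
  have lk: "Poly_Mapping.lookup (?E bs') (s, Suc k) = real (count_list (bs' ! k) s)"
    if "k < length u" "length bs' = Suc (length u)" for bs' s k
    using that by (simp add: lookup_exponent)
  show ?thesis
  proof (rule that[OF I c(1,2) h(1)])
    fix k s assume k: "k < length u"
    have "real (count_list (bs ! k) s) = Poly_Mapping.lookup (\<Sum>i\<in>I. c i *\<^sub>R i) (s, Suc k)"
      unfolding c(3) using bs by (intro lk[symmetric] k) (simp add: factorizations_def)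
    also have "\<dots> = (\<Sum>i\<in>I. c i * Poly_Mapping.lookup i (s, Suc k))"
      by (simp add: lookup_sum)
    also have "\<dots> = (\<Sum>i\<in>I. c i * real (count_list (h i ! k) s))"
    proof (rule sum.cong)
      fix i assume i: "i \<in> I"
      have "Poly_Mapping.lookup i (s, Suc k) = Poly_Mapping.lookup (?E (h i)) (s, Suc k)"
        using h(2)[OF i] by simp
      also have "\<dots> = real (count_list (h i ! k) s)"
        using h(1)[OF i] k by (intro lk) (auto simp: factorizations_def)
      finally show "c i * Poly_Mapping.lookup i (s, Suc k) = c i * real (count_list (h i ! k) s)"
        by simp
    qed simp
    finally show "real (count_list (bs ! k) s) = (\<Sum>i\<in>I. c i * real (count_list (h i ! k) s))" .
  qed
qed

section \<open>Products of upper triangular matrices as maximal walks\<close>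

definition word_mat :: "nat \<Rightarrow> ('a \<Rightarrow> trop mat) \<Rightarrow> 'a list \<Rightarrow> trop mat" where
  "word_mat n A w = foldr (\<lambda>s M. A s * M) w (1\<^sub>m n)"

text \<open>A walk visits the states in the list \<open>c\<close>. It reads the \<open>k\<close>-th block, with letter counts \<open>q ! k\<close>, in
  loops at the \<open>k\<close>-th state.\<close>

definition loop_weight :: "('a::finite \<Rightarrow> trop mat) \<Rightarrow> nat list \<Rightarrow> ('a \<Rightarrow> nat) list \<Rightarrow> trop" where
  "loop_weight A c q = (\<Prod>k<length c. \<Prod>s\<in>UNIV. A s $$ (c ! k, c ! k) ^ (q ! k) s)"

definition jump_weight :: "('a \<Rightarrow> trop mat) \<Rightarrow> nat list \<Rightarrow> 'a list \<Rightarrow> trop" where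
  "jump_weight A c u = (\<Prod>k<length u. A (u ! k) $$ (c ! k, c ! Suc k))"

lemma word_mat_Nil [simp]: "word_mat n A [] = 1\<^sub>m n"
  by (simp add: word_mat_def)

lemma word_mat_Cons [simp]: "word_mat n A (s # w) = A s * word_mat n A w"
  by (simp add: word_mat_def)

lemma word_mat_carrier [simp]:
  "(\<And>s. A s \<in> carrier_mat n n) \<Longrightarrow> word_mat n A w \<in> carrier_mat n n"
  by (induction w) (auto intro: mult_carrier_mat)

lemma word_mat_append:
  assumes "\<And>s. A s \<in> carrier_mat n n"
  shows "word_mat n A (w @ v) = word_mat n A w * word_mat n A v"
proof (induction w)
  case Nil
  then show ?case using left_mult_one_mat[OF word_mat_carrier[of A n v]] assms by simp
next
  case (Cons s w)
  then show ?case
    using assoc_mult_mat[OF assms word_mat_carrier[of A n w] word_mat_carrier[of A n v]] assms by simp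
qed

lemma word_mat_UT:
  assumes "\<And>s. A s \<in> UT n"
  shows "word_mat n A w \<in> UT n"
proof (induction w)
  case Nil
  then show ?case by (auto simp: UT_def)
next
  case (Cons s w)
  then show ?case using assms by (simp add: UT_times_closed)
qed

lemma word_mat_hom:
  assumes "\<And>s. A s \<in> UT n"
  shows "free_semigroup_hom (word_mat n A) (UT n)"
  using word_mat_UT[of A n] word_mat_append[of A n] assms
  by (auto simp: free_semigroup_hom_def UT_def)

lemma hom_eq_word_mat:
  assumes "free_semigroup_hom \<phi> (UT n)" "w \<noteq> []"
  shows "\<phi> w = word_mat n (\<lambda>s. \<phi> [s]) w"
  using assms(2)
proof (induction w rule: list_nonempty_induct)
  case (single s)
  have "\<phi> [s] \<in> carrier_mat n n" using assms(1) by (simp add: free_semigroup_hom_def UT_def)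
  then show ?case by simp
next
  case (cons s w)
  have "\<phi> ([s] @ w) = \<phi> [s] * \<phi> w"
    using assms(1) cons.hyps by (simp only: free_semigroup_hom_def) blast
  then show ?case using cons.IH by simp
qed

lemma word_mat_Cons_entry:
  assumes "\<And>s. A s \<in> carrier_mat n n" "i < n" "j < n"
  shows "word_mat n A (s # w) $$ (i, j) = (\<Sum>k<n. A s $$ (i, k) * word_mat n A w $$ (k, j))"
proof -
  have "dim_row (A s) = n" "dim_col (A s) = n" "dim_row (word_mat n A w) = n" "dim_col (word_mat n A w) = n"
    using assms(1)[of s] word_mat_carrier[of A n w, OF assms(1)] by (auto dest: carrier_matD)
  then show ?thesis using assms(2,3) by (simp add: scalar_prod_def atLeast0LessThan)
qed

lemma word_mat_Cons_ge:
  assumes "\<And>s. A s \<in> carrier_mat n n" "i < n" "j < n" "k < n"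
  shows "A s $$ (i, k) * word_mat n A w $$ (k, j) \<le> word_mat n A (s # w) $$ (i, j)"
  unfolding word_mat_Cons_entry[of A n, OF assms(1-3)]
  using assms(4) by (intro trop_member_le_sum) auto

lemma prod_power_count_Cons:
  fixes y :: "'a::finite \<Rightarrow> trop"
  shows "(\<Prod>s\<in>UNIV. y s ^ count_list (a # b) s) = y a * (\<Prod>s\<in>UNIV. y s ^ count_list b s)"
proof -
  have "(\<Prod>s\<in>UNIV. y s ^ count_list (a # b) s)
      = (\<Prod>s\<in>UNIV. (if s = a then y s else 1) * y s ^ count_list b s)"
    by (intro prod.cong) auto
  then show ?thesis by (simp add: prod.distrib)
qed

lemma loop_weight_Cons:
  "loop_weight A (i # c) (f # q) = (\<Prod>s\<in>UNIV. A s $$ (i, i) ^ f s) * loop_weight A c q"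
  unfolding loop_weight_def length_Cons prod.lessThan_Suc_shift by simp

lemma jump_weight_Cons:
  "c \<noteq> [] \<Longrightarrow> jump_weight A (i # c) (a # u) = A a $$ (i, hd c) * jump_weight A c u"
  unfolding jump_weight_def length_Cons prod.lessThan_Suc_shift by (simp add: hd_conv_nth)

lemma loops_le_word_mat_append:
  fixes A :: "'a::finite \<Rightarrow> trop mat"
  assumes A: "\<And>s. A s \<in> carrier_mat n n" and "i < n" "j < n"
  shows "(\<Prod>s\<in>UNIV. A s $$ (i, i) ^ count_list b s) * word_mat n A w $$ (i, j)
    \<le> word_mat n A (b @ w) $$ (i, j)"
proof (induction b)
  case (Cons a b)
  have "(\<Prod>s\<in>UNIV. A s $$ (i, i) ^ count_list (a # b) s) * word_mat n A w $$ (i, j)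
      \<le> A a $$ (i, i) * word_mat n A (b @ w) $$ (i, j)"
    unfolding prod_power_count_Cons mult.assoc using Cons.IH by (intro mult_left_mono) auto
  also have "\<dots> \<le> word_mat n A ((a # b) @ w) $$ (i, j)"
    using word_mat_Cons_ge[of A n, OF A assms(2,3,2), of a "b @ w"] by simp
  finally show ?case .
qed simp

text \<open>Every walk is one of the terms that a tropical matrix product maximizes over.\<close>

lemma path_weight_le_word_mat:
  fixes A :: "'a::finite \<Rightarrow> trop mat"
  assumes A: "\<And>s. A s \<in> carrier_mat n n"
    and "bs \<in> factorizations u w" "length c = Suc (length u)" "set c \<subseteq> {..<n}"
  shows "jump_weight A c u * loop_weight A c (map count_list bs) \<le> word_mat n A w $$ (hd c, last c)"
  using assms(2-)
proof (induction u arbitrary: bs w c)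
  case Nil
  then obtain i where c: "c = [i]" "i < n" by (auto simp: length_Suc_conv)
  have "bs = [w]" using Nil by (simp add: factorizations_Nil)
  then show ?case
    using loops_le_word_mat_append[of A n, OF A c(2) c(2), of w "[]"] c
    by (simp add: loop_weight_def jump_weight_def)
next
  case (Cons a u)
  obtain b bs' w' where bs: "bs = b # bs'" and w: "w = b @ a # w'" and bs': "bs' \<in> factorizations u w'"
    using Cons.prems(1) by (auto simp: factorizations_Cons)
  obtain i c' where c: "c = i # c'" and c': "length c' = Suc (length u)" using Cons.prems(2)
    by (auto simp: length_Suc_conv)
  have ne: "c' \<noteq> []" using c' by auto
  have i: "i < n" and sub: "set c' \<subseteq> {..<n}" using Cons.prems(3) c by auto
  have hl: "hd c' < n" "last c' < n" using ne sub by (meson hd_in_set last_in_set lessThan_iff subsetD)+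
  let ?L = "\<Prod>s\<in>UNIV. A s $$ (i, i) ^ count_list b s"
  have "jump_weight A c (a # u) * loop_weight A c (map count_list bs)
      = ?L * (A a $$ (i, hd c') * (jump_weight A c' u * loop_weight A c' (map count_list bs')))"
    by (simp add: c bs jump_weight_Cons[OF ne] loop_weight_Cons mult_ac)
  also have "\<dots> \<le> ?L * (A a $$ (i, hd c') * word_mat n A w' $$ (hd c', last c'))"
    using Cons.IH[OF bs' c' sub] by (intro mult_left_mono) auto
  also have "\<dots> \<le> ?L * word_mat n A (a # w') $$ (i, last c')"
    using word_mat_Cons_ge[of A n, OF A i hl(2) hl(1)] by (intro mult_left_mono) auto
  also have "\<dots> \<le> word_mat n A w $$ (i, last c')"
    unfolding w by (rule loops_le_word_mat_append[of A n, OF A i hl(2)])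
  finally show ?case using ne by (simp add: c)
qed

text \<open>A nonzero entry is the weight of some walk. Reading \<open>w\<close> from the left, the first letter either
  loops, and then it joins the first block, or it moves to a state that is larger because the
  matrices are upper triangular, and then it becomes the first letter of \<open>u\<close>, preceded by an empty
  block.\<close>

lemma word_mat_attained_by_path:
  fixes A :: "'a::finite \<Rightarrow> trop mat"
  assumes A: "\<And>s. A s \<in> UT n" and "i < n" "j < n" "word_mat n A w $$ (i, j) \<noteq> 0"
  obtains c u bs where "bs \<in> factorizations u w" "length c = Suc (length u)" "set c \<subseteq> {..<n}"
    "sorted_wrt (<) c" "hd c = i" "last c = j"
    "word_mat n A w $$ (i, j) = jump_weight A c u * loop_weight A c (map count_list bs)"
  using assms(2-)
proof (induction w arbitrary: i thesis)
  case Nil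
  then have "i = j" by (simp split: if_splits)
  show ?case
    by (rule Nil.prems(1)[of "[[]]" "[]" "[i]"])
       (use Nil.prems(2,3) \<open>i = j\<close> in \<open>simp_all add: factorizations_Nil jump_weight_def loop_weight_def\<close>)
next
  case (Cons a w)
  have A': "A s \<in> carrier_mat n n" for s using A by (simp add: UT_def)
  have entry: "word_mat n A (a # w) $$ (i, j) = (\<Sum>k<n. A a $$ (i, k) * word_mat n A w $$ (k, j))"
    by (rule word_mat_Cons_entry[of A n, OF A' Cons.prems(2,3)])
  obtain k where k: "k < n" and eq: "word_mat n A (a # w) $$ (i, j) = A a $$ (i, k) * word_mat n A w $$ (k, j)"
    using trop_sum_attained[of "\<lambda>k. A a $$ (i, k) * word_mat n A w $$ (k, j)" "{..<n}"] Cons.prems(4)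
    unfolding entry by auto
  have nz: "A a $$ (i, k) \<noteq> 0" "word_mat n A w $$ (k, j) \<noteq> 0"
    using Cons.prems(4) unfolding eq by auto
  have "i \<le> k"
  proof (rule ccontr)
    assume "\<not> i \<le> k"
    then have "A a $$ (i, k) = 0" using A[of a] Cons.prems(2) by (auto simp: UT_def)
    then show False using nz by simp
  qed
  obtain c u bs where IH: "bs \<in> factorizations u w" "length c = Suc (length u)" "set c \<subseteq> {..<n}"
    "sorted_wrt (<) c" "hd c = k" "last c = j"
    "word_mat n A w $$ (k, j) = jump_weight A c u * loop_weight A c (map count_list bs)"
    using Cons.IH[OF _ k Cons.prems(3) nz(2)] by blast
  then have c: "c = k # tl c" "c \<noteq> []" by (cases c; auto)+
  show ?case
  proof (cases "k = i")
    case True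
    obtain b bs' where bs: "bs = b # bs'" using IH(1) by (cases bs) (auto simp: factorizations_def)
    have "(a # b) # bs' \<in> factorizations u (a # w)"
      using IH(1) unfolding bs by (cases u) (auto simp: factorizations_def)
    moreover have "word_mat n A (a # w) $$ (i, j)
        = jump_weight A c u * loop_weight A c (map count_list ((a # b) # bs'))"
    proof -
      obtain c' where c': "c = i # c'" using c True by auto
      have "loop_weight A c (map count_list ((a # b) # bs'))
          = A a $$ (i, i) * loop_weight A c (map count_list bs)"
        unfolding c' bs list.map loop_weight_Cons prod_power_count_Cons by (rule mult.assoc)
      then show ?thesis using eq IH(7) True by (simp add: mult_ac)
    qed
    ultimately show ?thesis
      using Cons.prems(1) IH True by blast
  next
    case False
    then have "i < k" using \<open>i \<le> k\<close> by simp
    show ?thesis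
    proof (rule Cons.prems(1)[of "[] # bs" "a # u" "i # c"])
      show "[] # bs \<in> factorizations (a # u) (a # w)" using IH(1) by (auto simp: factorizations_Cons)
      have "k \<le> x" if "x \<in> set c" for x
        using IH(4) that c(1) by (metis set_ConsD sorted_wrt.simps(2) less_imp_le order_refl)
      then show "sorted_wrt (<) (i # c)" using IH(4) \<open>i < k\<close> by (auto intro: less_le_trans)
      show "word_mat n A (a # w) $$ (i, j)
          = jump_weight A (i # c) (a # u) * loop_weight A (i # c) (map count_list ([] # bs))"
        unfolding eq IH(7) by (simp add: jump_weight_Cons c(2) loop_weight_Cons IH(5) mult_ac)
    qed (use IH c Cons.prems(2) in auto)
  qed
qed

section \<open>Equal polytopes give equal matrices\<close>

lemma count_list_factorization:
  assumes "bs \<in> factorizations u w"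
  shows "count_list w s = count_list u s + (\<Sum>k<Suc (length u). count_list (bs ! k) s)"
  using assms
proof (induction u arbitrary: bs w)
  case Nil
  then show ?case by (simp add: factorizations_Nil)
next
  case (Cons a u)
  then obtain b bs' w' where "bs = b # bs'" "w = b @ a # w'" "bs' \<in> factorizations u w'"
    by (auto simp: factorizations_Cons)
  then show ?case using Cons.IH[of bs' w']
    unfolding list.size add_Suc_right add_0_right by (subst sum.lessThan_Suc_shift) simp
qed

text \<open>The exponent of \<open>x (s, 1)\<close> in \<open>g_poly [s] w\<close> is largest for the last occurrence of \<open>s\<close>, where it is one
  less than the number of all occurrences.\<close>

lemma Newt_subset_letter_count_le:
  fixes w v :: "'a::finite list"
  assumes "Newt (g_poly [s] w) \<subseteq> Newt (g_poly [s] v)"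
  shows "count_list w s \<le> count_list v s"
proof (cases "s \<in> set w")
  case True
  then obtain b b' where w: "w = b @ s # b'" "s \<notin> set b'" using split_list_last by metis
  then have "[b, b'] \<in> factorizations [s] w" by (simp add: factorizations_def)
  then obtain I :: "('a \<times> nat \<Rightarrow>\<^sub>0 real) set" and c h where I: "finite I" "\<And>i. i \<in> I \<Longrightarrow> 0 \<le> c i" "sum c I = 1"
    and h: "\<And>i. i \<in> I \<Longrightarrow> h i \<in> factorizations [s] v"
    and eq: "\<And>k t. k < length [s] \<Longrightarrow>
      real (count_list ([b, b'] ! k) t) = (\<Sum>i\<in>I. c i * real (count_list (h i ! k) t))"
    by (rule Newt_subset_convex_combination[OF assms]) blast
  \<comment> \<open>At the argument 1 the monomial simply is the exponent, as a real number.\<close>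
  have "\<exists>i\<in>I. (\<Prod>t\<in>{s}. Fin 1 ^ count_list b t) \<le> (\<Prod>t\<in>{s}. Fin 1 ^ count_list (h i ! 0) t)"
    using I eq[of 0] by (intro tropical_monomial_convex[where c = c]) auto
  then obtain i where i: "i \<in> I" "count_list b s \<le> count_list (h i ! 0) s"
    by (auto simp: Fin_power)
  have "count_list v s = Suc (count_list (h i ! 0) s + count_list (h i ! 1) s)"
    using count_list_factorization[OF h[OF i(1)], of s] by simp
  then show ?thesis using i(2) w by simp
qed (simp add: count_list_0_iff)

text \<open>The letter counts of \<open>d\<close> blocks of a factorization are convex combinations by the inclusion of the
  polytopes. Those of the last block follow along, since all blocks together contain the letters of
  the word that are not in \<open>u\<close>, and these are as many for \<open>v\<close> as for \<open>w\<close>.\<close>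

lemma Newt_subset_dominating_factorization:
  fixes w v :: "'a::finite list" and y :: "'a \<times> nat \<Rightarrow> trop"
  assumes sub: "Newt (g_poly u w) \<subseteq> Newt (g_poly u v)" and bs: "bs \<in> factorizations u w"
    and count: "\<And>s. count_list w s = count_list v s"
  obtains bs' where "bs' \<in> factorizations u v"
    "(\<Prod>k<Suc (length u). \<Prod>s\<in>UNIV. y (s, Suc k) ^ count_list (bs ! k) s)
      \<le> (\<Prod>k<Suc (length u). \<Prod>s\<in>UNIV. y (s, Suc k) ^ count_list (bs' ! k) s)"
proof -
  let ?d = "length u"
  obtain I :: "('a \<times> nat \<Rightarrow>\<^sub>0 real) set" and c h where I: "finite I" "\<And>i. i \<in> I \<Longrightarrow> 0 \<le> c i" "sum c I = 1"
    and h: "\<And>i. i \<in> I \<Longrightarrow> h i \<in> factorizations u v"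
    and eq: "\<And>k s. k < ?d \<Longrightarrow>
      real (count_list (bs ! k) s) = (\<Sum>i\<in>I. c i * real (count_list (h i ! k) s))"
    by (rule Newt_subset_convex_combination[OF sub bs]) blast
  \<comment> \<open>The constant \<open>r\<close> passes through the combination because the weights sum to 1.\<close>
  have last: "real (count_list (bs ! ?d) s) = (\<Sum>i\<in>I. c i * real (count_list (h i ! ?d) s))" for s
  proof -
    define r where "r = real (count_list v s) - real (count_list u s)"
    have hd: "real (count_list (h i ! ?d) s) = r - (\<Sum>k<?d. real (count_list (h i ! k) s))" if "i \<in> I" for i
      using count_list_factorization[OF h[OF that], of s] by (simp add: r_def)
    have "real (count_list (bs ! ?d) s) = r - (\<Sum>k<?d. real (count_list (bs ! k) s))"
      using count_list_factorization[OF bs, of s] count[of s] by (simp add: r_def)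
    also have "(\<Sum>k<?d. real (count_list (bs ! k) s)) = (\<Sum>k<?d. \<Sum>i\<in>I. c i * real (count_list (h i ! k) s))"
      using eq by (intro sum.cong) auto
    also have "\<dots> = (\<Sum>i\<in>I. c i * (\<Sum>k<?d. real (count_list (h i ! k) s)))"
      unfolding sum_distrib_left by (rule sum.swap)
    also have "r - \<dots> = (\<Sum>i\<in>I. c i * (r - (\<Sum>k<?d. real (count_list (h i ! k) s))))"
      using I(3) by (simp add: right_diff_distrib sum_subtractf flip: sum_distrib_right)
    also have "\<dots> = (\<Sum>i\<in>I. c i * real (count_list (h i ! ?d) s))"
      using hd by (intro sum.cong) auto
    finally show ?thesis .
  qed
  have all: "real (count_list (bs ! k) s) = (\<Sum>i\<in>I. c i * real (count_list (h i ! k) s))"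
    if "k < Suc ?d" for k s
    using eq[of k s] last[of s] that by (cases "k = ?d") auto
  let ?z = "\<lambda>(k, s). y (s, Suc k)" and ?f = "\<lambda>bs (k, s). count_list (bs ! k) s"
  have "\<exists>i\<in>I. (\<Prod>p\<in>{..<Suc ?d} \<times> UNIV. ?z p ^ ?f bs p) \<le> (\<Prod>p\<in>{..<Suc ?d} \<times> UNIV. ?z p ^ ?f (h i) p)"
    using I all by (intro tropical_monomial_convex[where c = c]) (auto simp del: lessThan_Suc)
  then obtain i where i: "i \<in> I"
    "(\<Prod>p\<in>{..<Suc ?d} \<times> UNIV. ?z p ^ ?f bs p) \<le> (\<Prod>p\<in>{..<Suc ?d} \<times> UNIV. ?z p ^ ?f (h i) p)"
    by blast
  show ?thesis
    by (rule that[OF h[OF i(1)]]) (use i(2) in \<open>simp add: prod.cartesian_product split_def del: prod.lessThan_Suc lessThan_Suc\<close>)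
qed

text \<open>The heaviest walk along \<open>w\<close> is replaced by one along \<open>v\<close> with the same states and the same moving
  letters, so that only the loops change their weight. The word \<open>u\<close> is shorter than \<open>n\<close> because the
  states strictly increase.\<close>

lemma word_mat_le_of_Newt_subset:
  fixes w v :: "'a::finite list"
  assumes A: "\<And>s. A s \<in> UT n" and "i < n" "j < n"
    and count: "\<And>s. count_list w s = count_list v s"
    and sub: "\<And>u. 1 \<le> length u \<Longrightarrow> length u < n \<Longrightarrow> Newt (g_poly u w) \<subseteq> Newt (g_poly u v)"
  shows "word_mat n A w $$ (i, j) \<le> word_mat n A v $$ (i, j)"
proof (cases "word_mat n A w $$ (i, j) = 0")
  case False
  have A': "A s \<in> carrier_mat n n" for s using A by (simp add: UT_def)
  obtain c u bs where p: "bs \<in> factorizations u w" "length c = Suc (length u)" "set c \<subseteq> {..<n}"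
    "sorted_wrt (<) c" "hd c = i" "last c = j"
    "word_mat n A w $$ (i, j) = jump_weight A c u * loop_weight A c (map count_list bs)"
    using word_mat_attained_by_path[of A n, OF A assms(2,3) False] by metis
  have "distinct c" using p(4) by (simp add: strict_sorted_iff)
  then have "length c \<le> n"
    using card_mono[OF _ p(3)] by (simp add: distinct_card)
  then have d: "length u < n" using p(2) by simp
  have "Newt (g_poly u w) \<subseteq> Newt (g_poly u v)"
  \<comment> \<open>A walk that never moves yields the empty word, for which both polytopes are the origin.\<close>
  proof (cases "u = []")
    case True
    have "exponent 0 q = 0" for q :: "('a \<Rightarrow> nat) list" by (simp add: exponent_def)
    then show ?thesis using True by (simp add: Newt_def keys_g_poly factorizations_Nil)
  next
    case False
    then show ?thesis using d by (intro sub) (simp_all add: Suc_leI)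
  qed
  from Newt_subset_dominating_factorization[OF this p(1) count,
      of "\<lambda>(s, k). A s $$ (c ! (k - 1), c ! (k - 1))"]
  obtain bs' where bs': "bs' \<in> factorizations u v"
    and le: "(\<Prod>k<Suc (length u). \<Prod>s\<in>UNIV. A s $$ (c ! k, c ! k) ^ count_list (bs ! k) s)
      \<le> (\<Prod>k<Suc (length u). \<Prod>s\<in>UNIV. A s $$ (c ! k, c ! k) ^ count_list (bs' ! k) s)"
    by (auto simp del: prod.lessThan_Suc)
  have loop: "loop_weight A c (map count_list bs)
      = (\<Prod>k<Suc (length u). \<Prod>s\<in>UNIV. A s $$ (c ! k, c ! k) ^ count_list (bs ! k) s)"
    if "length bs = Suc (length u)" for bs
    unfolding loop_weight_def p(2) using that by (intro prod.cong) auto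
  have "word_mat n A w $$ (i, j) \<le> jump_weight A c u * loop_weight A c (map count_list bs')"
    unfolding p(7) using le p(1) bs' by (intro mult_left_mono) (simp_all add: loop factorizations_def del: prod.lessThan_Suc)
  also have "\<dots> \<le> word_mat n A v $$ (i, j)"
    using path_weight_le_word_mat[of A n, OF A' bs' p(2,3)] p(5,6) by simp
  finally show ?thesis .
qed simp

lemma UT_equiv_of_Newt_eq:
  fixes w v :: "'a::finite list"
  assumes "w \<noteq> []" "v \<noteq> []" "n \<ge> 2"
    and eq: "\<And>u. 1 \<le> length u \<Longrightarrow> length u < n \<Longrightarrow> Newt (g_poly u w) = Newt (g_poly u v)"
  shows "UT_equiv n w v"
  unfolding UT_equiv_def
proof (intro allI impI)
  fix \<phi> :: "'a list \<Rightarrow> trop mat"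
  assume hom: "free_semigroup_hom \<phi> (UT n)"
  define A where "A s = \<phi> [s]" for s
  have A: "A s \<in> UT n" for s using hom by (simp add: A_def free_semigroup_hom_def)
  have count: "count_list w s = count_list v s" for s
    using eq[of "[s]"] assms(3) by (intro antisym Newt_subset_letter_count_le) simp_all
  have "word_mat n A w = word_mat n A v"
  proof (rule eq_matI)
    have dims: "word_mat n A x \<in> carrier_mat n n" for x
      using word_mat_UT[of A n] A by (simp add: UT_def)
    show "dim_row (word_mat n A w) = dim_row (word_mat n A v)" "dim_col (word_mat n A w) = dim_col (word_mat n A v)"
      using dims[of w] dims[of v] by auto
    fix i j assume "i < dim_row (word_mat n A v)" "j < dim_col (word_mat n A v)"
    then have ij: "i < n" "j < n" using dims[of v] by auto
    show "word_mat n A w $$ (i, j) = word_mat n A v $$ (i, j)"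
      using count eq by (intro antisym word_mat_le_of_Newt_subset[of A n, OF A ij]) auto
  qed
  then show "\<phi> w = \<phi> v"
    unfolding A_def using hom_eq_word_mat[OF hom assms(1)] hom_eq_word_mat[OF hom assms(2)] by simp
qed

section \<open>Evaluating the polynomials by matrices\<close>

text \<open>A walk can move only from \<open>i\<close> to \<open>i + 1\<close> while reading the letter \<open>u ! i\<close>. The loops at the state
  \<open>length u\<close>, where the last block is read, have the neutral weight, because the polynomials have no
  variables for that block. The states beyond are never reached.\<close>

definition staircase_mat :: "nat \<Rightarrow> 'a list \<Rightarrow> ('a \<times> nat \<Rightarrow> real) \<Rightarrow> 'a \<Rightarrow> trop mat" where
  "staircase_mat n u x s = Matrix.mat n n (\<lambda>(i, j).
     if i = j then if i < length u then Fin (x (s, Suc i)) else 1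
     else if j = Suc i \<and> i < length u \<and> u ! i = s then 1 else 0)"

lemma staircase_mat_UT: "staircase_mat n u x s \<in> UT n"
  by (auto simp: staircase_mat_def UT_def)

text \<open>A walk of nonzero weight that ends in the state \<open>length u\<close> has no choice: it climbs one state at a
  time and reads the corresponding letters of \<open>u\<close>. The induction needs an arbitrary starting state.\<close>

lemma staircase_jump_nonzero:
  assumes "jump_weight (staircase_mat n u x) c u' \<noteq> 0" "length c = Suc (length u')"
    "set c \<subseteq> {..<n}" "sorted_wrt (<) c" "last c = length u"
  shows "c = [hd c..<Suc (length u)] \<and> u' = drop (hd c) u"
  using assms
proof (induction u' arbitrary: c)
  case Nil
  then show ?case by (auto simp: length_Suc_conv)
next
  case (Cons a u')
  then obtain i c' where c: "c = i # c'" and c': "length c' = Suc (length u')" "c' \<noteq> []"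
    by (auto simp: length_Suc_conv)
  have "staircase_mat n u x a $$ (i, hd c') \<noteq> 0" and nz: "jump_weight (staircase_mat n u x) c' u' \<noteq> 0"
    using Cons.prems(1) by (auto simp: c jump_weight_Cons[OF c'(2)])
  moreover have "i < hd c'" "i < n" "hd c' < n"
    using Cons.prems(3,4) hd_in_set[OF c'(2)] by (auto simp: c)
  ultimately have i: "hd c' = Suc i" "i < length u" "u ! i = a"
    by (auto simp: staircase_mat_def split: if_splits)
  have "c' = [hd c'..<Suc (length u)] \<and> u' = drop (hd c') u"
    using Cons.prems c' nz by (intro Cons.IH) (auto simp: c)
  then show ?case using i by (simp add: c upt_conv_Cons del: upt_Suc) (metis Cons_nth_drop_Suc)
qed

lemma staircase_mat_entry:
  fixes u w :: "'a::finite list"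
  assumes "length u < n"
  shows "word_mat n (staircase_mat n u x) w $$ (0, length u) = trop_eval (g_poly u w) (\<lambda>v. Fin (x v))"
proof (rule antisym)
  let ?A = "staircase_mat n u x" and ?d = "length u"
  let ?c = "[0..<Suc ?d]" and ?M = "\<lambda>m. \<Prod>v\<in>UNIV \<times> {1..length u}. Fin (x v) ^ Poly_Mapping.lookup m v"
  have A: "?A s \<in> carrier_mat n n" for s using staircase_mat_UT[of n u x s] by (simp add: UT_def)
  have jump: "jump_weight ?A ?c u = 1"
    unfolding jump_weight_def using assms by (intro prod.neutral) (auto simp: staircase_mat_def simp del: upt_Suc)
  have loop: "loop_weight ?A ?c (map count_list bs) = ?M (exponent ?d (map count_list bs))"
    if "bs \<in> factorizations u w" for bs
  proof -
    have "loop_weight ?A ?c (map count_list bs)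
        = (\<Prod>k<Suc ?d. \<Prod>s\<in>UNIV. (if k < ?d then Fin (x (s, Suc k)) else 1) ^ (map count_list bs ! k) s)"
      unfolding loop_weight_def using assms
      by (intro prod.cong) (auto simp: staircase_mat_def simp del: upt_Suc)
    also have "\<dots> = (\<Prod>k<?d. \<Prod>s\<in>UNIV. Fin (x (s, Suc k)) ^ (map count_list bs ! k) s)"
      by simp
    finally show ?thesis by (simp only: prod_exponent)
  qed
  show "word_mat n ?A w $$ (0, ?d) \<le> trop_eval (g_poly u w) (\<lambda>v. Fin (x v))"
  proof (cases "word_mat n ?A w $$ (0, ?d) = 0")
    case False
    have "0 < n" using assms by simp
    from word_mat_attained_by_path[of ?A n, OF staircase_mat_UT this assms False]
    obtain c u' bs where p: "bs \<in> factorizations u' w" "length c = Suc (length u')" "set c \<subseteq> {..<n}"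
      "sorted_wrt (<) c" "hd c = 0" "last c = ?d"
      "word_mat n ?A w $$ (0, ?d) = jump_weight ?A c u' * loop_weight ?A c (map count_list bs)"
      by metis
    have "jump_weight ?A c u' \<noteq> 0" using False p(7) by auto
    from staircase_jump_nonzero[OF this p(2,3,4,6)] p(5) have c: "c = ?c" "u' = u" by simp_all
    have "word_mat n ?A w $$ (0, ?d) = ?M (exponent ?d (map count_list bs))"
      using p(1,7) jump loop by (simp add: c del: upt_Suc)
    also have "\<dots> \<le> trop_eval (g_poly u w) (\<lambda>v. Fin (x v))"
      unfolding trop_eval_g_poly using p(1) by (intro trop_member_le_sum finite_keys) (auto simp: keys_g_poly c)
    finally show ?thesis .
  qed simp
  show "trop_eval (g_poly u w) (\<lambda>v. Fin (x v)) \<le> word_mat n ?A w $$ (0, ?d)"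
  proof (cases "trop_eval (g_poly u w) (\<lambda>v. Fin (x v)) = 0")
    case False
    then obtain m where m: "m \<in> Poly_Mapping.keys (g_poly u w)"
      "trop_eval (g_poly u w) (\<lambda>v. Fin (x v)) = ?M m"
      unfolding trop_eval_g_poly by (rule trop_sum_attained)
    then obtain bs where bs: "bs \<in> factorizations u w" "m = exponent ?d (map count_list bs)"
      by (auto simp: keys_g_poly)
    have "jump_weight ?A ?c u * loop_weight ?A ?c (map count_list bs) \<le> word_mat n ?A w $$ (hd ?c, last ?c)"
      using assms by (intro path_weight_le_word_mat[of ?A n, OF A bs(1)]) auto
    moreover have "hd ?c = 0" "last ?c = ?d" by (simp_all add: hd_append)
    ultimately show ?thesis using jump loop[OF bs(1)] m(2) bs(2) by (simp del: upt_Suc)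
  qed simp
qed

section \<open>The cycle of implications\<close>

lemma same_function_of_UT_equiv:
  fixes w v :: "'a::finite list"
  assumes "UT_equiv n w v" "length u < n"
  shows "same_function (g_poly u w) (g_poly u v)"
  unfolding same_function_def
proof
  fix x :: "'a \<times> nat \<Rightarrow> real"
  have "word_mat n (staircase_mat n u x) w = word_mat n (staircase_mat n u x) v"
    using assms(1) word_mat_hom[of "staircase_mat n u x", OF staircase_mat_UT]
    unfolding UT_equiv_def by blast
  then show "trop_eval (g_poly u w) (\<lambda>v. Fin (x v)) = trop_eval (g_poly u v) (\<lambda>v. Fin (x v))"
    using staircase_mat_entry[OF assms(2), of x] by metis
qed

lemma Newt_eq_of_same_function:
  assumes "same_function (g_poly u w) (g_poly u v)"
  shows "Newt (g_poly u w) = Newt (g_poly u v)"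
  using assms by (intro antisym Newt_mono_of_function_le lookup_g_poly_keys) (simp_all add: same_function_def)

lemma signature_eq_iff:
  fixes w v :: "'a::{finite,linorder} list"
  shows "signature n w = signature n v \<longleftrightarrow>
    (\<forall>u. 1 \<le> length u \<longrightarrow> length u < n \<longrightarrow> Newt (g_poly u w) = Newt (g_poly u v))"
proof -
  have "finite {u :: 'a list. length u = d}" for d
    using finite_lists_length_eq[of "UNIV :: 'a set" d] by simp
  then show ?thesis
    by (auto simp: signature_def d_signature_def)
qed

theorem theorem2p4:
  fixes w v :: "'a::{finite,linorder} list" and n :: nat
  assumes "w \<noteq> []" and "v \<noteq> []" and "n \<ge> 2"
  shows "(UT_equiv n w v \<longleftrightarrow>
           (\<forall>d \<in> {1..n - 1}. \<forall>u. length u = d \<longrightarrow> same_function (g_poly u w) (g_poly u v))) \<and>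
         (UT_equiv n w v \<longleftrightarrow> signature n w = signature n v)"
proof -
  have 1: "\<forall>d \<in> {1..n - 1}. \<forall>u. length u = d \<longrightarrow> same_function (g_poly u w) (g_poly u v)"
    if "UT_equiv n w v"
    using same_function_of_UT_equiv[OF that] assms(3) by auto
  have 2: "signature n w = signature n v"
    if "\<forall>d \<in> {1..n - 1}. \<forall>u. length u = d \<longrightarrow> same_function (g_poly u w) (g_poly u v)"
    unfolding signature_eq_iff using that Newt_eq_of_same_function by fastforce
  have 3: "UT_equiv n w v" if "signature n w = signature n v"
    using that unfolding signature_eq_iff by (intro UT_equiv_of_Newt_eq assms) auto
  show ?thesis using 1 2 3 by blast
qed

end
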